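(* Let $m,n,L$ be integers with $1\le m<n$, $L\ge 1$ and $L\mid m$. The average stopping set weight distribution of the redundant random ensemble $\mathcal R_{m,n}^{(L)}$ satisfies, for every integer $w$ with $1\le w\le n$, $$S_w^{\mathcal R_{m,n}^{(L)}}\ \ge\ \binom{n}{w}\max\{A^{m/L},\,2^{-m}\},$$ $$S_w^{\mathcal R_{m,n}^{(L)}}\ \le\ \binom{n}{w}\left(\frac{1-w2^{-w}}{(2^L-1)\,w2^{-w}+1-w2^{-w}}\right)^{m/L},$$ where $A=\max\{1-(2^L-1)2^{-w}w,\ 0\}$.
   Context: For $h,x\in\{0,1\}^n$ let $h\circ x=\sum_{i=1}^n h_ix_i$, computed in the integers. For a binary matrix $M$ with $n$ columns and $x\in\{0,1\}^n$, let $q_M(x)$ be the number of rows $h$ of $M$ (counted by row index) with $h\circ x=1$; $x$ is a stopping set (SS) vector of $M$ if $q_M(x)=0$. Let $S_w(M)$ be the number of SS vectors of $M$ of Hamming weight $w$. Redundant extension: let $H$ be a binary $m\times n$ matrix ($1\le m<n$) with rows $h_1,\dots,h_m$, and let $L\ge1$ divide $m$. Partition the rows into $m/L$ consecutive blocks of $L$ rows. $H^{(L)}$ is the $(2^L-1)(m/L)\times n$ binary matrix whose rows are, for each block, all $2^L-1$ linear combinations over $F_2$ of the $L$ rows of the block with nonzero coefficient vector (one row for each nonzero coefficient vector in $F_2^L$). The random ensemble $\mathcal R_{m,n}$ is the set of all $2^{mn}$ binary $m\times n$ matrices. The redundant random ensemble $\mathcal R_{m,n}^{(L)}$ is the family $\{H^{(L)}: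 H\in\mathcal R_{m,n}\}$, each member (indexed by $H$) having probability $2^{-mn}$. For an ensemble $\mathcal G$ with uniform probability, $S_w^{\mathcal G}$ is the expectation of $S_w(M)$ over $M\in\mathcal G$; thus $S_w^{\mathcal R_{m,n}^{(L)}}=2^{-mn}\sum_{H\in\mathcal R_{m,n}}S_w(H^{(L)})$. *)

theory Defs
  imports
    "HOL-Probability.Probability_Mass_Function"
    "HOL-Library.Z2"
    "Jordan_Normal_Form.Matrix"
begin

text \<open>
  Matrices and vectors over the field \<^typ>\<open>bit\<close> of two elements are those of the
  Jordan-Normal-Form library. The syntax of \<^theory>\<open>HOL-Analysis.Finite_Cartesian_Product\<close>
  is switched off because it uses the same symbol for vector components.
\<close>

unbundle no vec_syntax

text \<open>
  Entries are coerced to integers before they are multiplied and summed: this is not the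
  scalar product over \<^typ>\<open>bit\<close>.
\<close>

definition int_scalar_prod :: "bit vec \<Rightarrow> bit vec \<Rightarrow> int" where
  "int_scalar_prod h x = (\<Sum>i<dim_vec x. of_bit (h $ i) * of_bit (x $ i))"

definition hamming_weight :: "bit vec \<Rightarrow> nat" where
  "hamming_weight x = card {i. i < dim_vec x \<and> x $ i \<noteq> 0}"

definition num_one_rows :: "bit mat \<Rightarrow> bit vec \<Rightarrow> nat" where
  "num_one_rows M x = card {i. i < dim_row M \<and> int_scalar_prod (row M i) x = 1}"

definition is_ss_vec :: "bit mat \<Rightarrow> bit vec \<Rightarrow> bool" where
  "is_ss_vec M x \<longleftrightarrow> x \<in> carrier_vec (dim_col M) \<and> num_one_rows M x = 0"

definition ss_weight_dist :: "bit mat \<Rightarrow> nat \<Rightarrow> nat" where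
  "ss_weight_dist M w = card {x. is_ss_vec M x \<and> hamming_weight x = w}"

text \<open>
  The coefficient vectors of length \<open>L\<close> are numbered by their binary expansions; the nonzero
  ones get the numbers \<open>1, \<dots>, 2 ^ L - 1\<close>, see \<open>bij_betw_coeff_vec\<close>.
\<close>

definition coeff_vec :: "nat \<Rightarrow> nat \<Rightarrow> bit vec" where
  "coeff_vec L k = vec L (\<lambda>t. of_bool (Bit_Operations.bit k t))"

text \<open>
  Row \<open>b * (2 ^ L - 1) + k\<close> with \<open>k < 2 ^ L - 1\<close> is the combination of the rows
  \<open>b * L, \<dots>, b * L + (L - 1)\<close> of \<open>H\<close> with coefficient vector number \<open>k + 1\<close>
  (addition and multiplication in \<^typ>\<open>bit\<close>).
\<close>

definition redundant_ext :: "nat \<Rightarrow> bit mat \<Rightarrow> bit mat" where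
  "redundant_ext L H =
     mat ((2 ^ L - 1) * (dim_row H div L)) (dim_col H)
       (\<lambda>(i, j). \<Sum>t<L. coeff_vec L (i mod (2 ^ L - 1) + 1) $ t
                       * H $$ (i div (2 ^ L - 1) * L + t, j))"

definition random_ensemble :: "nat \<Rightarrow> nat \<Rightarrow> bit mat pmf" where
  "random_ensemble m n = pmf_of_set (carrier_mat m n)"

text \<open>
  The members are indexed by \<open>H\<close>: a matrix that is the extension of several \<open>H\<close>
  has the corresponding multiple of the probability \<open>1 / 2 ^ (m * n)\<close>.
\<close>

definition redundant_ensemble :: "nat \<Rightarrow> nat \<Rightarrow> nat \<Rightarrow> bit mat pmf" where
  "redundant_ensemble m n L = map_pmf (redundant_ext L) (random_ensemble m n)"

definition avg_ss_weight_dist :: "bit mat pmf \<Rightarrow> nat \<Rightarrow> real" where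
  "avg_ss_weight_dist G w = measure_pmf.expectation G (\<lambda>M. real (ss_weight_dist M w))"


lemma UNIV_bit_eq: "(UNIV :: bit set) = {0, 1}"
  using bit_not_one_iff by blast

lemma bij_betw_coeff_vec:
  "bij_betw (coeff_vec L) {1..2 ^ L - 1} (carrier_vec L - {0\<^sub>v L})"
proof -
  have inj: "inj_on (coeff_vec L) {..<2 ^ L}"
  proof (rule inj_onI)
    fix k l :: nat
    assume kl: "k \<in> {..<2 ^ L}" "l \<in> {..<2 ^ L}" and eq: "coeff_vec L k = coeff_vec L l"
    have low: "Bit_Operations.bit k t = Bit_Operations.bit l t" if "t < L" for t
    proof -
      have "coeff_vec L k $ t = coeff_vec L l $ t"
        by (simp add: eq)
      then show ?thesis
        using that
        by (cases "Bit_Operations.bit k t"; cases "Bit_Operations.bit l t")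
          (simp_all add: coeff_vec_def)
    qed
    have "take_bit L k = take_bit L l"
      by (rule bit_eqI) (auto simp: bit_take_bit_iff low)
    then show "k = l"
      using kl by (simp add: take_bit_nat_eq_self)
  qed
  have surj: "carrier_vec L \<subseteq> coeff_vec L ` {..<2 ^ L}"
  proof
    fix v :: "bit vec"
    assume v: "v \<in> carrier_vec L"
    let ?k = "horner_sum of_bool (2 :: nat) (map (\<lambda>t. v $ t = 1) [0..<L])"
    have "?k < 2 ^ L"
      using horner_sum_of_bool_2_less[of "map (\<lambda>t. v $ t = 1) [0..<L]", where 'a = nat] by simp
    moreover have "coeff_vec L ?k = v"
    proof (rule eq_vecI)
      fix t assume "t < dim_vec v"
      then have t: "t < L" using v by simp
      then show "coeff_vec L ?k $ t = v $ t"
        by (cases "v $ t") (simp_all add: coeff_vec_def bit_horner_sum_bit_iff)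
    qed (use v in \<open>simp add: coeff_vec_def\<close>)
    ultimately show "v \<in> coeff_vec L ` {..<2 ^ L}"
      by (metis imageI lessThan_iff)
  qed
  have "coeff_vec L ` {..<2 ^ L} \<subseteq> carrier_vec L"
    by (auto simp: coeff_vec_def)
  with surj inj have "bij_betw (coeff_vec L) {..<2 ^ L} (carrier_vec L)"
    by (auto simp: bij_betw_def)
  moreover have zero: "coeff_vec L 0 = 0\<^sub>v L"
    by (intro eq_vecI) (simp_all add: coeff_vec_def)
  ultimately have "bij_betw (coeff_vec L) ({..<2 ^ L} - {0}) (carrier_vec L - {0\<^sub>v L})"
    by (intro bij_betw_DiffI) (auto simp: bij_betw_def)
  moreover have "{..<2 ^ L} - {0 :: nat} = {1..2 ^ L - 1}"
    by (auto simp: less_Suc_eq_le[symmetric])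
  ultimately show ?thesis by simp
qed

lemma bij_betw_carrier_mat:
  "bij_betw (\<lambda>f. mat m n f) (({..<m} \<times> {..<n}) \<rightarrow>\<^sub>E UNIV) (carrier_mat m n)"
proof (rule bij_betwI[where g = "\<lambda>M. restrict (\<lambda>ij. M $$ ij) ({..<m} \<times> {..<n})"])
  fix f :: "nat \<times> nat \<Rightarrow> 'a"
  assume "f \<in> ({..<m} \<times> {..<n}) \<rightarrow>\<^sub>E UNIV"
  then have "f ij = undefined" if "ij \<notin> {..<m} \<times> {..<n}" for ij
    using that by (rule PiE_arb)
  then show "restrict (\<lambda>ij. mat m n f $$ ij) ({..<m} \<times> {..<n}) = f"
    unfolding restrict_def by (intro ext) (metis (no_types, lifting) SigmaE index_mat(1) lessThan_iff)
qed auto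

lemma
  shows finite_carrier_mat_bit: "finite (carrier_mat m n :: bit mat set)"
    and card_carrier_mat_bit: "card (carrier_mat m n :: bit mat set) = 2 ^ (m * n)"
proof -
  let ?F = "({..<m} \<times> {..<n}) \<rightarrow>\<^sub>E (UNIV :: bit set)"
  have "finite ?F"
    by (intro finite_PiE) (simp_all add: UNIV_bit_eq)
  then show "finite (carrier_mat m n :: bit mat set)"
    using bij_betw_finite[OF bij_betw_carrier_mat] by blast
  have "card ?F = 2 ^ (m * n)"
    by (simp add: card_PiE UNIV_bit_eq numeral_2_eq_2)
  then show "card (carrier_mat m n :: bit mat set) = 2 ^ (m * n)"
    using bij_betw_same_card[OF bij_betw_carrier_mat[where ?'a = bit], of m n] by simp
qed

lemma avg_ss_weight_dist_redundant_ensemble: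
  "avg_ss_weight_dist (redundant_ensemble m n L) w =
     (\<Sum>H\<in>carrier_mat m n. real (ss_weight_dist (redundant_ext L H) w)) / 2 ^ (m * n)"
proof -
  have "(carrier_mat m n :: bit mat set) \<noteq> {}"
    by (metis empty_iff zero_carrier_mat)
  then show ?thesis
    by (simp add: avg_ss_weight_dist_def redundant_ensemble_def random_ensemble_def
        integral_pmf_of_set finite_carrier_mat_bit card_carrier_mat_bit)
qed

end

theory Submission
  imports Defs
begin

text \<open>
  Fix \<open>x\<close> of weight \<open>w\<close>. The \<open>m / L\<close> blocks are independent, so it suffices to estimate the
  probability that no nonzero combination of the rows of one block meets the support of \<open>x\<close>
  exactly once. Each combination is uniformly distributed and hence does so with probability
  \<open>p = w / 2 ^ w\<close>, and different combinations are pairwise independent. The lower bound \<open>A\<close> is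
  the union bound, the lower bound \<open>1 / 2 ^ L\<close> comes from the blocks whose rows are all
  orthogonal to \<open>x\<close> over the field of two elements, and the upper bound is a second moment
  estimate.
\<close>

unbundle no inner_syntax

section \<open>Counting\<close>

text \<open>The injections \<open>\<tau>\<close> embed every fibre of \<open>\<phi>\<close> over
  \<open>K\<close> into every other one, so all fibres are equally large and \<open>\<phi>\<close>
  maps a uniform element of \<open>G\<close> to a uniform element of \<open>K\<close>. The product
  form avoids division and covers empty \<open>K\<close>.\<close>

lemma card_vimage_equidistributed:
  assumes fin: "finite G" "finite K" and \<phi>: "\<phi> \<in> G \<rightarrow> K" and S: "S \<subseteq> K"
    and shift: "\<And>k l. k \<in> K \<Longrightarrow> l \<in> K \<Longrightarrow>
      \<exists>\<tau>. inj_on \<tau> G \<and> \<tau> ` {g \<in> G. \<phi> g = k} \<subseteq> {g \<in> G. \<phi> g = l}"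
  shows "card {g \<in> G. \<phi> g \<in> S} * card K = card S * card G"
proof -
  let ?F = "\<lambda>k. {g \<in> G. \<phi> g = k}"
  have le: "card (?F k) \<le> card (?F l)" if "k \<in> K" "l \<in> K" for k l
  proof -
    obtain \<tau> where \<tau>: "inj_on \<tau> G" "\<tau> ` ?F k \<subseteq> ?F l"
      using shift[OF \<open>k \<in> K\<close> \<open>l \<in> K\<close>] by blast
    have "inj_on \<tau> (?F k)"
      using \<tau>(1) by (rule inj_on_subset) auto
    with \<tau>(2) show ?thesis
      using fin by (intro card_inj_on_le[of \<tau>]) auto
  qed
  have count: "card {g \<in> G. \<phi> g \<in> T} = (\<Sum>k\<in>T. card (?F k))" if "T \<subseteq> K" for T
  proof -
    have "{g \<in> G. \<phi> g \<in> T} = (\<Union>k\<in>T. ?F k)"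
      by auto
    also have "card \<dots> = (\<Sum>k\<in>T. card (?F k))"
      using fin finite_subset[OF that] by (intro card_UN_disjoint) auto
    finally show ?thesis .
  qed
  have G: "{g \<in> G. \<phi> g \<in> K} = G"
    using \<phi> by auto
  show ?thesis
  proof (cases "K = {}")
    case True
    then show ?thesis
      using S by auto
  next
    case False
    then obtain k where k: "k \<in> K"
      by auto
    have eq: "card (?F l) = card (?F k)" if "l \<in> K" for l
      using le[OF k that] le[OF that k] by simp
    have "card {g \<in> G. \<phi> g \<in> T} = card T * card (?F k)" if "T \<subseteq> K" for T
      using count[OF that] that eq by (simp add: subset_eq)
    from this[OF S] this[OF subset_refl] show ?thesis
      by (simp add: G)
  qed
qed

text \<open>The Chung-Erdos inequality: Cauchy-Schwarz for the number of events that occur.\<close>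

lemma card_avoid_pairwise_independent_le:
  fixes E :: "'i \<Rightarrow> 'a set" and p :: real
  assumes fin: "finite \<Omega>" "finite I" and sub: "\<And>i. i \<in> I \<Longrightarrow> E i \<subseteq> \<Omega>"
    and single: "\<And>i. i \<in> I \<Longrightarrow> real (card (E i)) = p * real (card \<Omega>)"
    and pair: "\<And>i j. i \<in> I \<Longrightarrow> j \<in> I \<Longrightarrow> i \<noteq> j \<Longrightarrow>
      real (card (E i \<inter> E j)) = p\<^sup>2 * real (card \<Omega>)"
    and p: "0 \<le> p" "p < 1"
  shows "real (card (\<Omega> - (\<Union>i\<in>I. E i)))
    \<le> real (card \<Omega>) * ((1 - p) / (real (card I) * p + 1 - p))"
proof -
  define U where "U = (\<Union>i\<in>I. E i)"
  define g where "g = real (card \<Omega>)"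
  define k where "k = real (card I)"
  \<comment> \<open>\<open>N\<close> counts the events that occur. It vanishes outside
    \<open>U\<close>, so its moments over \<open>\<Omega>\<close> are already sums over
    \<open>U\<close>.\<close>
  define N :: "'a \<Rightarrow> real" where "N \<omega> = (\<Sum>i\<in>I. of_bool (\<omega> \<in> E i))" for \<omega>
  have U: "U \<subseteq> \<Omega>" "finite U"
    using sub fin by (auto simp: U_def intro: finite_subset)
  have Ei: "U \<inter> E i = E i" if "i \<in> I" for i
    using that by (auto simp: U_def)
  have "(\<Sum>\<omega>\<in>U. N \<omega>) = (\<Sum>i\<in>I. \<Sum>\<omega>\<in>U. of_bool (\<omega> \<in> E i))"
    unfolding N_def by (rule sum.swap)
  also have "\<dots> = (\<Sum>i\<in>I. p * g)"
    using U(2) by (intro sum.cong) (simp_all add: of_bool_def sum.If_cases Ei single g_def)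
  finally have N1: "(\<Sum>\<omega>\<in>U. N \<omega>) = k * p * g"
    by (simp add: k_def)
  have "(\<Sum>\<omega>\<in>U. (N \<omega>)\<^sup>2) = (\<Sum>\<omega>\<in>U. \<Sum>i\<in>I. \<Sum>j\<in>I. of_bool (\<omega> \<in> E i \<inter> E j))"
    unfolding N_def power2_eq_square sum_product
    by (intro sum.cong refl) (simp flip: of_bool_conj)
  also have "\<dots> = (\<Sum>i\<in>I. \<Sum>\<omega>\<in>U. \<Sum>j\<in>I. of_bool (\<omega> \<in> E i \<inter> E j))"
    by (rule sum.swap)
  also have "\<dots> = (\<Sum>i\<in>I. \<Sum>j\<in>I. \<Sum>\<omega>\<in>U. of_bool (\<omega> \<in> E i \<inter> E j))"
    by (intro sum.cong refl sum.swap)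
  \<comment> \<open>Diagonal pairs contribute the first moment; all other pairs are governed by
    pairwise independence.\<close>
  also have "\<dots> = (\<Sum>i\<in>I. \<Sum>j\<in>I. if j = i then p * g else p\<^sup>2 * g)"
  proof (intro sum.cong refl)
    fix i j assume ij: "i \<in> I" "j \<in> I"
    have "(\<Sum>\<omega>\<in>U. of_bool (\<omega> \<in> E i \<inter> E j)) = real (card (U \<inter> (E i \<inter> E j)))"
      using U(2) by (simp only: sum_of_bool_eq Collect_mem_eq)
    also have "U \<inter> (E i \<inter> E j) = E i \<inter> E j"
      using Ei[OF ij(1)] by auto
    finally show "(\<Sum>\<omega>\<in>U. of_bool (\<omega> \<in> E i \<inter> E j)) = (if j = i then p * g else p\<^sup>2 * g)"
      using ij by (auto simp: g_def single pair)
  qed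
  also have "\<dots> = (\<Sum>i\<in>I. p * g + (k - 1) * (p\<^sup>2 * g))"
  proof (intro sum.cong refl)
    fix i assume "i \<in> I"
    then have "card I \<ge> 1"
      using fin(2) by (metis One_nat_def Suc_leI card_gt_0_iff empty_iff)
    then show "(\<Sum>j\<in>I. if j = i then p * g else p\<^sup>2 * g) = p * g + (k - 1) * (p\<^sup>2 * g)"
      using \<open>i \<in> I\<close> fin(2)
      by (simp add: sum.remove[OF fin(2) \<open>i \<in> I\<close>] k_def card_Diff_singleton of_nat_diff)
  qed
  finally have N2: "(\<Sum>\<omega>\<in>U. (N \<omega>)\<^sup>2) = k * p * g * (k * p + 1 - p)"
    by (simp add: k_def power2_eq_square algebra_simps)
  \<comment> \<open>Cauchy-Schwarz for \<open>N\<close> and the constant function one on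
    \<open>U\<close>.\<close>
  have CS: "(k * p * g)\<^sup>2 \<le> k * p * g * (k * p + 1 - p) * real (card U)"
    using Cauchy_Schwarz_ineq_sum[of N "\<lambda>_. 1" U] by (simp add: N1 N2)
  have nonneg: "k * p * g \<ge> 0"
    using p by (simp add: k_def g_def)
  have pos: "k * p + 1 - p > 0"
  proof -
    have "k * p \<ge> 0"
      using p by (simp add: k_def)
    with p show ?thesis
      by linarith
  qed
  \<comment> \<open>The factor \<open>k * p * g\<close> is cancelled from \<open>CS\<close>; if it
    is zero, only nonnegativity of the right-hand side remains to be seen.\<close>
  have "k * p * g \<le> (k * p + 1 - p) * real (card U)"
  proof (cases "k * p * g = 0")
    case True
    show ?thesis
      unfolding True using pos by simp
  next
    case False
    with nonneg have "k * p * g > 0"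
      by (rule le_neq_trans[OF _ not_sym])
    moreover have "(k * p * g) * (k * p * g) \<le> (k * p * g) * ((k * p + 1 - p) * real (card U))"
      using CS by (simp add: power2_eq_square mult.assoc)
    ultimately show ?thesis
      using mult_le_cancel_left_pos by blast
  qed
  \<comment> \<open>Passing to the complement: both sides are subtracted from
    \<open>g * (k * p + 1 - p)\<close>.\<close>
  then have "(g - real (card U)) * (k * p + 1 - p) \<le> g * (1 - p)"
    by (simp add: algebra_simps)
  then have "g - real (card U) \<le> g * (1 - p) / (k * p + 1 - p)"
    using pos by (simp add: pos_le_divide_eq)
  moreover have "real (card (\<Omega> - U)) = g - real (card U)"
    using U fin card_mono[OF fin(1) U(1)] by (simp add: card_Diff_subset g_def of_nat_diff)
  ultimately show ?thesis
    by (simp add: U_def g_def k_def)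
qed

text \<open>Such a \<open>B\<close> is determined by its single element in \<open>T\<close> and its
  arbitrary part outside \<open>T\<close>.\<close>

lemma card_intersecting_once:
  assumes "finite A" "T \<subseteq> A"
  shows "card {B \<in> Pow A. card (B \<inter> T) = 1} = card T * 2 ^ (card A - card T)"
proof -
  have "bij_betw (\<lambda>(t, C). insert t C) (T \<times> Pow (A - T)) {B \<in> Pow A. card (B \<inter> T) = 1}"
  proof (rule bij_betwI[where g = "\<lambda>B. (the_elem (B \<inter> T), B - T)"])
    show "(\<lambda>(t, C). insert t C) \<in> T \<times> Pow (A - T) \<rightarrow> {B \<in> Pow A. card (B \<inter> T) = 1}"
    proof -
      have "card (insert t C \<inter> T) = 1" if "t \<in> T" "C \<subseteq> A - T" for t C
      proof -
        from that have "insert t C \<inter> T = {t}"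
          by auto
        then show ?thesis
          by simp
      qed
      then show ?thesis
        using assms by auto
    qed
  next
    fix y assume y: "y \<in> T \<times> Pow (A - T)"
    obtain t C where tC: "y = (t, C)"
      by (cases y)
    with y have "insert t C \<inter> T = {t}" "insert t C - T = C"
      by auto
    then show "(the_elem ((case y of (t, C) \<Rightarrow> insert t C) \<inter> T), (case y of (t, C) \<Rightarrow> insert t C) - T) = y"
      by (simp only: tC prod.case) simp
  qed (auto simp: card_1_singleton_iff)
  then have "card {B \<in> Pow A. card (B \<inter> T) = 1} = card (T \<times> Pow (A - T))"
    by (simp add: bij_betw_same_card)
  also have "\<dots> = card T * 2 ^ (card A - card T)"
    using assms by (simp add: card_cartesian_product card_Pow card_Diff_subset finite_subset)
  finally show ?thesis .
qed

section \<open>Binary vectors\<close>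

text \<open>Identifies binary vectors with sets of coordinates, so that weights and integer products
  become cardinalities.\<close>

definition bit_support :: "bit vec \<Rightarrow> nat set" where
  "bit_support x = {i. i < dim_vec x \<and> x $ i = 1}"

lemma bij_betw_bit_support: "bij_betw bit_support (carrier_vec n) (Pow {..<n})"
proof (rule bij_betwI[where g = "\<lambda>T. vec n (\<lambda>i. of_bool (i \<in> T))"])
  fix x :: "bit vec" assume "x \<in> carrier_vec n"
  then show "vec n (\<lambda>i. of_bool (i \<in> bit_support x)) = x"
    by (intro eq_vecI) (auto simp: bit_support_def)
qed (auto simp: bit_support_def)

lemma card_carrier_vec_bit: "card (carrier_vec n :: bit vec set) = 2 ^ n"
  using bij_betw_same_card[OF bij_betw_bit_support] by (simp add: card_Pow)

lemma finite_carrier_vec_bit: "finite (carrier_vec n :: bit vec set)"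
  using bij_betw_finite[OF bij_betw_bit_support] by simp

lemma card_Collect_bit_support:
  "card {x \<in> carrier_vec n. P (bit_support x)} = card {T \<in> Pow {..<n}. P T}"
proof -
  have "bit_support ` {x \<in> carrier_vec n. P (bit_support x)} = {T \<in> Pow {..<n}. P T}"
    using bij_betw_bit_support[of n] by (auto simp: bij_betw_def) (metis (mono_tags, lifting) PowI imageE image_eqI mem_Collect_eq)
  moreover have "inj_on bit_support {x \<in> carrier_vec n. P (bit_support x)}"
    using bij_betw_bit_support[of n] by (auto simp: bij_betw_def intro: inj_on_subset)
  ultimately show ?thesis
    using card_image by metis
qed

lemma hamming_weight_eq: "hamming_weight x = card (bit_support x)"
  by (simp add: hamming_weight_def bit_support_def)

lemma card_hamming_weight: "card {x \<in> carrier_vec n. hamming_weight x = w} = n choose w"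
proof -
  have "{T \<in> Pow {..<n}. card T = w} = {T. T \<subseteq> {..<n} \<and> card T = w}"
    by auto
  then show ?thesis
    using card_Collect_bit_support[of n "\<lambda>T. card T = w"]
    by (simp add: hamming_weight_eq n_subsets)
qed

lemma int_scalar_prod_eq:
  assumes "dim_vec h = dim_vec x"
  shows "int_scalar_prod h x = int (card (bit_support h \<inter> bit_support x))"
proof -
  have "int_scalar_prod h x = (\<Sum>i<dim_vec x. of_bool (h $ i = 1 \<and> x $ i = 1))"
    by (simp add: int_scalar_prod_def flip: of_bool_conj)
  also have "\<dots> = int (card {i. i < dim_vec x \<and> h $ i = 1 \<and> x $ i = 1})"
    by (simp add: of_bool_def sum.If_cases lessThan_def Collect_conj_eq)
  also have "{i. i < dim_vec x \<and> h $ i = 1 \<and> x $ i = 1} = bit_support h \<inter> bit_support x"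
    using assms by (auto simp: bit_support_def)
  finally show ?thesis .
qed

text \<open>One coordinate in the support of \<open>x\<close> is selected for \<open>h\<close>, and
  the coordinates off that support are free.\<close>

lemma card_int_scalar_prod_one:
  assumes "x \<in> carrier_vec n"
  shows "card {h \<in> carrier_vec n. int_scalar_prod h x = 1}
    = hamming_weight x * 2 ^ (n - hamming_weight x)"
proof -
  have "{h \<in> carrier_vec n. int_scalar_prod h x = 1}
      = {h \<in> carrier_vec n. card (bit_support h \<inter> bit_support x) = 1}"
    using assms by (auto simp: int_scalar_prod_eq)
  moreover have "bit_support x \<subseteq> {..<n}"
    using assms by (auto simp: bit_support_def)
  ultimately show ?thesis
    using card_Collect_bit_support[of n "\<lambda>T. card (T \<inter> bit_support x) = 1"]
      card_intersecting_once[of "{..<n}" "bit_support x"]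
    by (simp add: hamming_weight_eq)
qed

text \<open>The product over \<open>bit\<close> is the parity of the integer product, and one is
  odd. This is what makes blocks orthogonal to \<open>x\<close> harmless.\<close>

lemma scalar_prod_bit_eq_0:
  assumes "dim_vec h = dim_vec x" "h \<bullet> x = 0"
  shows "int_scalar_prod h x \<noteq> 1"
proof -
  have "h \<bullet> x = (\<Sum>i<dim_vec x. of_bool (h $ i = 1 \<and> x $ i = 1))"
    unfolding scalar_prod_def lessThan_atLeast0 by (intro sum.cong) auto
  also have "\<dots> = of_nat (card {i. i < dim_vec x \<and> h $ i = 1 \<and> x $ i = 1})"
    by (simp add: of_bool_def sum.If_cases lessThan_def Collect_conj_eq)
  also have "{i. i < dim_vec x \<and> h $ i = 1 \<and> x $ i = 1} = bit_support h \<inter> bit_support x"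
    using assms by (auto simp: bit_support_def)
  finally have "of_nat (card (bit_support h \<inter> bit_support x)) = (0 :: bit)"
    using assms(2) by simp
  then show ?thesis
    using assms(1) by (auto simp: int_scalar_prod_eq)
qed

section \<open>Random binary matrices\<close>

text \<open>The rank-one matrix with column \<open>r\<close> and row \<open>u\<close>. Adding it
  moves the image of \<open>c\<close> by \<open>r\<close> scaled with \<open>u \<bullet> c\<close>,
  which gives control over single images.\<close>

definition outer_mat :: "'a :: semiring_0 vec \<Rightarrow> 'a vec \<Rightarrow> 'a mat" where
  "outer_mat r u = mat (dim_vec r) (dim_vec u) (\<lambda>(i, j). r $ i * u $ j)"

lemma outer_mat_carrier [simp]:
  "r \<in> carrier_vec nr \<Longrightarrow> u \<in> carrier_vec nc \<Longrightarrow> outer_mat r u \<in> carrier_mat nr nc"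
  by (simp add: outer_mat_def)

lemma outer_mat_mult_vec:
  fixes r u c :: "'a :: comm_semiring_0 vec"
  assumes "c \<in> carrier_vec (dim_vec u)"
  shows "outer_mat r u *\<^sub>v c = (u \<bullet> c) \<cdot>\<^sub>v r"
  using assms
  by (intro eq_vecI) (auto simp: outer_mat_def scalar_prod_def sum_distrib_left ac_simps)

text \<open>Translations serve as the maps \<open>\<tau>\<close> of
  \<open>card_vimage_equidistributed\<close>.\<close>

lemma inj_on_add_mat:
  fixes N :: "'a :: group_add mat"
  assumes "N \<in> carrier_mat nr nc"
  shows "inj_on (\<lambda>M. M + N) (carrier_mat nr nc)"
proof (rule inj_onI)
  fix M M' :: "'a mat"
  assume M: "M \<in> carrier_mat nr nc" "M' \<in> carrier_mat nr nc" and eq: "M + N = M' + N"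
  show "M = M'"
  proof (rule eq_matI)
    fix i j assume "i < dim_row M'" "j < dim_col M'"
    then show "M $$ (i, j) = M' $$ (i, j)"
      using arg_cong[OF eq, of "\<lambda>X. X $$ (i, j)"] assms M by simp
  qed (use M in auto)
qed

lemma vec_add_diff_cancel:
  fixes k l :: "'a :: ab_group_add vec"
  assumes "k \<in> carrier_vec n" "l \<in> carrier_vec n"
  shows "k + (l - k) = l"
  using assms by (intro eq_vecI) auto

lemma bit_vec_nonzeroE:
  fixes c :: "bit vec"
  assumes "c \<in> carrier_vec n" "c \<noteq> 0\<^sub>v n"
  obtains t where "t < n" "c $ t = 1"
proof -
  have "\<exists>t<n. c $ t \<noteq> 0"
  proof (rule ccontr)
    assume "\<not> ?thesis"
    then have "c = 0\<^sub>v n"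
      using assms(1) by (intro eq_vecI) auto
    with assms(2) show False ..
  qed
  then show ?thesis
    using that by auto
qed

text \<open>Over the field of two elements, distinct nonzero vectors are linearly independent, so a
  dual pair of functionals exists.\<close>

lemma dual_pair_bit_vec:
  fixes c d :: "bit vec"
  assumes cd: "c \<in> carrier_vec n" "d \<in> carrier_vec n" "c \<noteq> 0\<^sub>v n" "d \<noteq> 0\<^sub>v n" "c \<noteq> d"
  obtains u v where "u \<in> carrier_vec n" "v \<in> carrier_vec n"
    "u \<bullet> c = 1" "u \<bullet> d = 0" "v \<bullet> c = 0" "v \<bullet> d = 1"
proof -
  \<comment> \<open>The case of a coordinate where \<open>c\<close> is one and \<open>d\<close> is
    zero; the opposite case follows by exchanging \<open>c\<close> and \<open>d\<close>.\<close>
  have *: "\<exists>u v. u \<in> carrier_vec n \<and> v \<in> carrier_vec n \<and>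
      u \<bullet> c = 1 \<and> u \<bullet> d = 0 \<and> v \<bullet> c = 0 \<and> v \<bullet> d = 1"
    if c: "c \<in> carrier_vec n" and d: "d \<in> carrier_vec n" "d \<noteq> 0\<^sub>v n"
      and t: "t < n" "c $ t = 1" "d $ t = 0" for c d :: "bit vec" and t
  proof -
    obtain s where s: "s < n" "d $ s = 1"
      using d by (rule bit_vec_nonzeroE)
    \<comment> \<open>\<open>?u\<close> reads coordinate \<open>t\<close>, which already separates
      \<open>c\<close> from \<open>d\<close>. \<open>?v\<close> reads a coordinate where
      \<open>d\<close> is one; its correction term cancels the value at \<open>c\<close> in
      characteristic two and does not affect \<open>d\<close>.\<close>
    let ?u = "unit_vec n t" and ?v = "unit_vec n s + (c $ s) \<cdot>\<^sub>v unit_vec n t"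
    have v: "?v \<bullet> y = y $ s + c $ s * y $ t" if "y \<in> carrier_vec n" for y
      using that s(1) t(1) by (subst add_scalar_prod_distrib[where n = n]) simp_all
    have "?v \<bullet> c = 0" "?v \<bullet> d = 1"
      using v[OF c] v[OF d(1)] s t by (cases "c $ s"; simp)+
    then show ?thesis
      using c d s t by (intro exI[of _ ?u] exI[of _ ?v]) simp
  qed
  have "\<exists>t<n. c $ t \<noteq> d $ t"
  proof (rule ccontr)
    assume "\<not> ?thesis"
    then have "c = d"
      using cd by (intro eq_vecI) auto
    with cd(5) show False ..
  qed
  then obtain t where t: "t < n" "c $ t \<noteq> d $ t"
    by blast
  show ?thesis
  proof (cases "c $ t = 0")
    case True
    with t have "d $ t = 1"
      by simp
    with * [OF cd(2,1,3) t(1) _ True] that show ?thesis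
      by blast
  next
    case False
    with t have "c $ t = 1" "d $ t = 0"
      by (auto intro: ccontr)
    with * [OF cd(1,2,4) t(1)] that show ?thesis
      by blast
  qed
qed

text \<open>For nonzero \<open>c\<close> the product \<open>M *\<^sub>v c\<close> of a uniform
  matrix is a uniform vector.\<close>

lemma card_mult_vec_mem:
  fixes c :: "bit vec"
  assumes c: "c \<in> carrier_vec nc" "c \<noteq> 0\<^sub>v nc" and S: "S \<subseteq> carrier_vec nr"
  shows "card {M \<in> carrier_mat nr nc. M *\<^sub>v c \<in> S} * 2 ^ nr = card S * 2 ^ (nr * nc)"
proof -
  obtain t where t: "t < nc" "c $ t = 1"
    using c by (rule bit_vec_nonzeroE)
  let ?G = "carrier_mat nr nc :: bit mat set" and ?K = "carrier_vec nr :: bit vec set"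
  let ?u = "unit_vec nc t"
  have "card {M \<in> ?G. M *\<^sub>v c \<in> S} * card ?K = card S * card ?G"
  proof (rule card_vimage_equidistributed[OF finite_carrier_mat_bit finite_carrier_vec_bit _ S])
    show "(\<lambda>M. M *\<^sub>v c) \<in> ?G \<rightarrow> ?K"
      using c by auto
    fix k l :: "bit vec" assume kl: "k \<in> ?K" "l \<in> ?K"
    \<comment> \<open>Since \<open>c\<close> is one at \<open>t\<close>, this translation adds
      exactly \<open>l - k\<close> to the product with \<open>c\<close>.\<close>
    let ?N = "outer_mat (l - k) ?u"
    have N: "?N \<in> ?G"
      using kl by simp
    have "?N *\<^sub>v c = l - k"
      using c t by (simp add: outer_mat_mult_vec)
    then have "(M + ?N) *\<^sub>v c = l" if "M \<in> ?G" "M *\<^sub>v c = k" for M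
      using add_mult_distrib_mat_vec[OF that(1) N c(1)] that(2) vec_add_diff_cancel[OF kl] by simp
    then have "(\<lambda>M. M + ?N) ` {M \<in> ?G. M *\<^sub>v c = k} \<subseteq> {M \<in> ?G. M *\<^sub>v c = l}"
      using N by auto
    with inj_on_add_mat[OF N]
    show "\<exists>\<tau>. inj_on \<tau> ?G \<and> \<tau> ` {M \<in> ?G. M *\<^sub>v c = k} \<subseteq> {M \<in> ?G. M *\<^sub>v c = l}"
      by blast
  qed
  then show ?thesis
    by (simp add: card_carrier_vec_bit card_carrier_mat_bit)
qed

text \<open>The products with \<open>c\<close> and \<open>d\<close> are jointly uniform, hence
  independent: a dual pair allows either one to be moved without the other.\<close>

lemma card_mult_vec_mem_pair:
  fixes c d :: "bit vec"
  assumes cd: "c \<in> carrier_vec nc" "d \<in> carrier_vec nc" "c \<noteq> 0\<^sub>v nc" "d \<noteq> 0\<^sub>v nc" "c \<noteq> d"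
    and S: "S \<subseteq> carrier_vec nr"
  shows "card {M \<in> carrier_mat nr nc. M *\<^sub>v c \<in> S \<and> M *\<^sub>v d \<in> S} * (2 ^ nr)\<^sup>2
    = (card S)\<^sup>2 * 2 ^ (nr * nc)"
proof -
  obtain u v where uv: "u \<in> carrier_vec nc" "v \<in> carrier_vec nc"
    "u \<bullet> c = 1" "u \<bullet> d = 0" "v \<bullet> c = 0" "v \<bullet> d = 1"
    using cd by (rule dual_pair_bit_vec)
  let ?G = "carrier_mat nr nc :: bit mat set" and ?V = "carrier_vec nr :: bit vec set"
  let ?\<phi> = "\<lambda>M. (M *\<^sub>v c, M *\<^sub>v d)"
  have "card {M \<in> ?G. ?\<phi> M \<in> S \<times> S} * card (?V \<times> ?V) = card (S \<times> S) * card ?G"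
  proof (rule card_vimage_equidistributed)
    show "finite ?G" "finite (?V \<times> ?V)"
      by (simp_all add: finite_carrier_mat_bit finite_carrier_vec_bit)
    show "S \<times> S \<subseteq> ?V \<times> ?V"
      using S by auto
    show "?\<phi> \<in> ?G \<rightarrow> ?V \<times> ?V"
      using cd by auto
    fix k l :: "bit vec \<times> bit vec" assume kl: "k \<in> ?V \<times> ?V" "l \<in> ?V \<times> ?V"
    obtain k1 k2 l1 l2 where [simp]: "k = (k1, k2)" "l = (l1, l2)"
      by (cases k; cases l)
    have K: "k1 \<in> ?V" "k2 \<in> ?V" "l1 \<in> ?V" "l2 \<in> ?V"
      using kl by auto
    \<comment> \<open>\<open>?N1\<close> changes only the product with \<open>c\<close>, and
      \<open>?N2\<close> only the product with \<open>d\<close>.\<close>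
    let ?N1 = "outer_mat (l1 - k1) u" and ?N2 = "outer_mat (l2 - k2) v"
    have N: "?N1 \<in> ?G" "?N2 \<in> ?G" "?N1 + ?N2 \<in> ?G"
      using K uv by simp_all
    have "(?N1 + ?N2) *\<^sub>v c = l1 - k1"
    proof -
      have "(?N1 + ?N2) *\<^sub>v c = 1 \<cdot>\<^sub>v (l1 - k1) + 0 \<cdot>\<^sub>v (l2 - k2)"
        using uv cd by (simp only: add_mult_distrib_mat_vec[OF N(1,2) cd(1)] outer_mat_mult_vec carrier_vecD)
      also have "\<dots> = l1 - k1"
        using K by (intro eq_vecI) auto
      finally show ?thesis .
    qed
    then have 1: "(M + (?N1 + ?N2)) *\<^sub>v c = l1" if "M \<in> ?G" "M *\<^sub>v c = k1" for M
      using add_mult_distrib_mat_vec[OF that(1) N(3) cd(1)] that(2) vec_add_diff_cancel[OF K(1,3)]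
      by simp
    have "(?N1 + ?N2) *\<^sub>v d = l2 - k2"
    proof -
      have "(?N1 + ?N2) *\<^sub>v d = 0 \<cdot>\<^sub>v (l1 - k1) + 1 \<cdot>\<^sub>v (l2 - k2)"
        using uv cd by (simp only: add_mult_distrib_mat_vec[OF N(1,2) cd(2)] outer_mat_mult_vec carrier_vecD)
      also have "\<dots> = l2 - k2"
        using K by (intro eq_vecI) auto
      finally show ?thesis .
    qed
    then have 2: "(M + (?N1 + ?N2)) *\<^sub>v d = l2" if "M \<in> ?G" "M *\<^sub>v d = k2" for M
      using add_mult_distrib_mat_vec[OF that(1) N(3) cd(2)] that(2) vec_add_diff_cancel[OF K(2,4)]
      by simp
    have "(\<lambda>M. M + (?N1 + ?N2)) ` {M \<in> ?G. ?\<phi> M = k} \<subseteq> {M \<in> ?G. ?\<phi> M = l}"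
    proof (rule image_subsetI)
      fix M assume "M \<in> {M \<in> ?G. ?\<phi> M = k}"
      then show "M + (?N1 + ?N2) \<in> {M \<in> ?G. ?\<phi> M = l}"
        using 1[of M] 2[of M] add_carrier_mat[OF N(3), of M] by simp
    qed
    with inj_on_add_mat[OF N(3)]
    show "\<exists>\<tau>. inj_on \<tau> ?G \<and> \<tau> ` {M \<in> ?G. ?\<phi> M = k} \<subseteq> {M \<in> ?G. ?\<phi> M = l}"
      by blast
  qed
  then show ?thesis
    by (simp add: card_carrier_vec_bit card_carrier_mat_bit card_cartesian_product power2_eq_square)
qed

section \<open>A single block\<close>

text \<open>
  Blocks are stored transposed, so that the combination with coefficient vector \<open>c\<close> of the
  \<open>L\<close> rows of a block \<open>D\<close> is the product of \<open>D\<close> and \<open>c\<close>.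
\<close>

definition ss_blocks :: "nat \<Rightarrow> nat \<Rightarrow> bit vec \<Rightarrow> bit mat set" where
  "ss_blocks n L x =
     {D \<in> carrier_mat n L. \<forall>c \<in> carrier_vec L - {0\<^sub>v L}. int_scalar_prod (D *\<^sub>v c) x \<noteq> 1}"

definition hit_blocks :: "nat \<Rightarrow> nat \<Rightarrow> bit vec \<Rightarrow> bit vec \<Rightarrow> bit mat set" where
  "hit_blocks n L x c = {D \<in> carrier_mat n L. int_scalar_prod (D *\<^sub>v c) x = 1}"

lemma hit_blocks_subset: "hit_blocks n L x c \<subseteq> carrier_mat n L"
  by (auto simp: hit_blocks_def)

text \<open>Presents the good blocks as those avoiding a family of events, the form needed for both
  the second moment and the union bound.\<close>

lemma ss_blocks_eq:
  "ss_blocks n L x = carrier_mat n L - (\<Union>c \<in> carrier_vec L - {0\<^sub>v L}. hit_blocks n L x c)"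
  by (auto simp: ss_blocks_def hit_blocks_def)

lemma finite_ss_blocks: "finite (ss_blocks n L x)"
  by (rule finite_subset[OF _ finite_carrier_mat_bit[of n L]]) (auto simp: ss_blocks_def)

lemma hamming_weight_le: "x \<in> carrier_vec n \<Longrightarrow> hamming_weight x \<le> n"
  using card_mono[of "{..<n}" "bit_support x"]
  by (auto simp: hamming_weight_eq bit_support_def)

context
  fixes n L :: nat and x :: "bit vec" and p :: real
  assumes x: "x \<in> carrier_vec n"
  defines "p \<equiv> real (hamming_weight x) / 2 ^ hamming_weight x"
begin

text \<open>Rewrites the count \<open>w * 2 ^ (n - w)\<close> as a proportion of all vectors; the
  subtraction is harmless because the weight is at most \<open>n\<close>.\<close>

lemma card_weight_one_patterns:
  "real (card {h \<in> carrier_vec n. int_scalar_prod h x = 1}) = p * 2 ^ n"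
  using hamming_weight_le[OF x]
  by (simp add: card_int_scalar_prod_one[OF x] p_def power_diff[where 'a = real])

lemma card_hit_blocks:
  assumes c: "c \<in> carrier_vec L - {0\<^sub>v L}"
  shows "real (card (hit_blocks n L x c)) = p * 2 ^ (n * L)"
proof -
  let ?S = "{h \<in> carrier_vec n. int_scalar_prod h x = 1}"
  have "hit_blocks n L x c = {D \<in> carrier_mat n L. D *\<^sub>v c \<in> ?S}"
    using c by (auto simp: hit_blocks_def)
  then have "card (hit_blocks n L x c) * 2 ^ n = card ?S * 2 ^ (n * L)"
    using card_mult_vec_mem[of c L ?S n] c by simp
  then have "real (card (hit_blocks n L x c)) * 2 ^ n = real (card ?S) * 2 ^ (n * L)"
    by (metis (mono_tags, lifting) of_nat_mult of_nat_numeral of_nat_power)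
  then show ?thesis
    by (simp add: card_weight_one_patterns)
qed

lemma card_hit_blocks_Int:
  assumes c: "c \<in> carrier_vec L - {0\<^sub>v L}" and d: "d \<in> carrier_vec L - {0\<^sub>v L}" and "c \<noteq> d"
  shows "real (card (hit_blocks n L x c \<inter> hit_blocks n L x d)) = p\<^sup>2 * 2 ^ (n * L)"
proof -
  let ?S = "{h \<in> carrier_vec n. int_scalar_prod h x = 1}"
  let ?E = "hit_blocks n L x c \<inter> hit_blocks n L x d"
  have "?E = {D \<in> carrier_mat n L. D *\<^sub>v c \<in> ?S \<and> D *\<^sub>v d \<in> ?S}"
    using c d by (auto simp: hit_blocks_def)
  then have "card ?E * (2 ^ n)\<^sup>2 = (card ?S)\<^sup>2 * 2 ^ (n * L)"
    using card_mult_vec_mem_pair[of c L d ?S n] c d \<open>c \<noteq> d\<close> by simp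
  then have "real (card ?E) * (2 ^ n)\<^sup>2 = (real (card ?S))\<^sup>2 * 2 ^ (n * L)"
    by (metis (mono_tags, lifting) of_nat_mult of_nat_numeral of_nat_power)
  then show ?thesis
    by (simp add: card_weight_one_patterns power_mult_distrib)
qed

lemma card_nonzero_bit_vecs: "real (card (carrier_vec L - {0\<^sub>v L} :: bit vec set)) = 2 ^ L - 1"
  by (simp add: card_Diff_singleton card_carrier_vec_bit of_nat_diff)

lemma card_ss_blocks_le:
  "real (card (ss_blocks n L x)) \<le> 2 ^ (n * L) * ((1 - p) / ((2 ^ L - 1) * p + 1 - p))"
proof -
  \<comment> \<open>This is \<open>w < 2 ^ w\<close>.\<close>
  have "p < 1"
    by (simp add: p_def of_nat_less_two_power)
  moreover have "p \<ge> 0"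
    by (simp add: p_def)
  ultimately show ?thesis
    using card_avoid_pairwise_independent_le[of "carrier_mat n L" "carrier_vec L - {0\<^sub>v L}"
        "hit_blocks n L x" p, unfolded card_nonzero_bit_vecs, folded ss_blocks_eq]
    by (simp add: card_hit_blocks card_hit_blocks_Int hit_blocks_subset
        finite_carrier_mat_bit finite_carrier_vec_bit card_carrier_mat_bit)
qed

lemma card_ss_blocks_ge_union_bound:
  "real (card (ss_blocks n L x)) \<ge> 2 ^ (n * L) * (1 - (2 ^ L - 1) * p)"
proof -
  let ?C = "carrier_vec L - {0\<^sub>v L} :: bit vec set"
  let ?U = "\<Union>c\<in>?C. hit_blocks n L x c"
  have U: "?U \<subseteq> carrier_mat n L"
    by (auto simp: hit_blocks_def)
  have "real (card ?U) \<le> (\<Sum>c\<in>?C. real (card (hit_blocks n L x c)))"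
    using card_UN_le[of ?C "hit_blocks n L x"]
    by (simp add: finite_carrier_vec_bit flip: of_nat_sum)
  also have "\<dots> = (2 ^ L - 1) * (p * 2 ^ (n * L))"
    by (simp add: card_hit_blocks flip: card_nonzero_bit_vecs)
  finally have "real (card ?U) \<le> (2 ^ L - 1) * (p * 2 ^ (n * L))" .
  moreover have "real (card (ss_blocks n L x)) = 2 ^ (n * L) - real (card ?U)"
    using card_mono[OF finite_carrier_mat_bit U] finite_subset[OF U finite_carrier_mat_bit]
    by (simp add: ss_blocks_eq card_Diff_subset U card_carrier_mat_bit of_nat_diff)
  ultimately show ?thesis
    by (simp add: algebra_simps)
qed

text \<open>If all rows of a block are orthogonal to \<open>x\<close> over \<open>bit\<close>, so
  are their combinations, whose integer products with \<open>x\<close> are then even. For nonzero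
  \<open>x\<close> the vector of the \<open>L\<close> products is uniform, so it vanishes with
  probability \<open>1 / 2 ^ L\<close>.\<close>

lemma card_ss_blocks_ge_orthogonal:
  assumes "x \<noteq> 0\<^sub>v n"
  shows "real (card (ss_blocks n L x)) \<ge> 2 ^ (n * L) / 2 ^ L"
proof -
  let ?M = "{M \<in> carrier_mat L n. M *\<^sub>v x \<in> {0\<^sub>v L}}"
  \<comment> \<open>The matrices in \<open>?M\<close> have the vectors of the block as rows, whereas
    blocks have them as columns.\<close>
  have "transpose_mat ` ?M \<subseteq> ss_blocks n L x"
  proof (rule image_subsetI)
    fix M assume M: "M \<in> ?M"
    have "int_scalar_prod (transpose_mat M *\<^sub>v c) x \<noteq> 1" if c: "c \<in> carrier_vec L" for c
    proof (rule scalar_prod_bit_eq_0)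
      have "(transpose_mat M *\<^sub>v c) \<bullet> x = c \<bullet> (M *\<^sub>v x)"
        using M c x by (intro transpose_vec_mult_scalar) auto
      then show "(transpose_mat M *\<^sub>v c) \<bullet> x = 0"
        using M c by simp
    qed (use M x in auto)
    then show "transpose_mat M \<in> ss_blocks n L x"
      using M by (auto simp: ss_blocks_def)
  qed
  moreover have "inj_on transpose_mat ?M"
    by (metis (no_types, lifting) inj_onI transpose_transpose)
  ultimately have "card ?M \<le> card (ss_blocks n L x)"
    using finite_ss_blocks by (intro card_inj_on_le)
  moreover have "card ?M * 2 ^ L = 2 ^ (n * L)"
    using card_mult_vec_mem[OF x assms, of "{0\<^sub>v L}" L] by (simp add: mult.commute)
  then have "real (card ?M) * 2 ^ L = 2 ^ (n * L)"
    by (metis (mono_tags, lifting) of_nat_mult of_nat_numeral of_nat_power)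
  then have "real (card ?M) = 2 ^ (n * L) / 2 ^ L"
    by (simp add: field_simps)
  ultimately show ?thesis
    by linarith
qed

end

section \<open>Independence of the blocks\<close>

definition row_block :: "nat \<Rightarrow> 'a mat \<Rightarrow> nat \<Rightarrow> 'a mat" where
  "row_block L H b = mat (dim_col H) L (\<lambda>(j, t). H $$ (b * L + t, j))"

text \<open>Cutting a matrix into blocks loses nothing, so a uniform matrix amounts to
  \<open>B\<close> independent uniform blocks. The inverse finds row \<open>i\<close> in block
  \<open>i div L\<close> at position \<open>i mod L\<close>.\<close>

lemma bij_betw_row_blocks:
  assumes "L > 0"
  shows "bij_betw (\<lambda>H. \<lambda>b\<in>{..<B}. row_block L H b)
    (carrier_mat (B * L) n) ({..<B} \<rightarrow>\<^sub>E carrier_mat n L)"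
proof (rule bij_betwI[where g = "\<lambda>f. mat (B * L) n (\<lambda>(i, j). f (i div L) $$ (j, i mod L))"])
  show "(\<lambda>H. \<lambda>b\<in>{..<B}. row_block L H b)
    \<in> carrier_mat (B * L) n \<rightarrow> ({..<B} \<rightarrow>\<^sub>E carrier_mat n L)"
    by (auto simp: row_block_def)
next
  fix H :: "'a mat" assume H: "H \<in> carrier_mat (B * L) n"
  show "mat (B * L) n (\<lambda>(i, j). (\<lambda>b\<in>{..<B}. row_block L H b) (i div L) $$ (j, i mod L)) = H"
    using H assms
    by (intro eq_matI) (auto simp: row_block_def less_mult_imp_div_less)
next
  fix f :: "nat \<Rightarrow> 'a mat" assume f: "f \<in> {..<B} \<rightarrow>\<^sub>E carrier_mat n L"
  let ?H = "mat (B * L) n (\<lambda>(i, j). f (i div L) $$ (j, i mod L))"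
  have "row_block L ?H b = f b" if b: "b < B" for b
  proof (rule eq_matI)
    have fb: "f b \<in> carrier_mat n L"
      using f b by auto
    then show "dim_row (row_block L ?H b) = dim_row (f b)"
      "dim_col (row_block L ?H b) = dim_col (f b)"
      by (simp_all add: row_block_def)
    fix j t assume "j < dim_row (f b)" "t < dim_col (f b)"
    then have jt: "j < n" "t < L"
      using fb by auto
    have "b * L + t < Suc b * L"
      using jt by simp
    also have "\<dots> \<le> B * L"
      using b by (intro mult_le_mono1) simp
    finally have "b * L + t < B * L" .
    with jt show "row_block L ?H b $$ (j, t) = f b $$ (j, t)"
      by (simp add: row_block_def)
  qed
  then show "(\<lambda>b\<in>{..<B}. row_block L ?H b) = f"
    using f by (intro ext) (auto simp: restrict_def PiE_def extensional_def)
qed auto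

text \<open>Decodes the row index into a block and a coefficient vector; adding one to the remainder
  skips number 0, the zero vector.\<close>

lemma row_redundant_ext:
  assumes "i < (2 ^ L - 1) * (dim_row H div L)"
  shows "row (redundant_ext L H) i
    = row_block L H (i div (2 ^ L - 1)) *\<^sub>v coeff_vec L (i mod (2 ^ L - 1) + 1)"
proof (rule eq_vecI)
  fix j assume "j < dim_vec (row_block L H (i div (2 ^ L - 1)) *\<^sub>v coeff_vec L (i mod (2 ^ L - 1) + 1))"
  then have "j < dim_col H"
    by (simp add: row_block_def)
  then show "row (redundant_ext L H) i $ j
      = (row_block L H (i div (2 ^ L - 1)) *\<^sub>v coeff_vec L (i mod (2 ^ L - 1) + 1)) $ j"
    using assms
    by (simp add: redundant_ext_def row_block_def scalar_prod_def lessThan_atLeast0 coeff_vec_def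
        conj_commute del: mult_bit_eq_and)
qed (use assms in \<open>simp add: redundant_ext_def row_block_def\<close>)

text \<open>Quotient and remainder of the row index run through all pairs of a block and a nonzero
  coefficient vector, so the condition on the rows splits into one condition per block.\<close>

lemma is_ss_vec_redundant_ext_iff:
  assumes "L > 0" and H: "H \<in> carrier_mat (B * L) n" and x: "x \<in> carrier_vec n"
  shows "is_ss_vec (redundant_ext L H) x \<longleftrightarrow> (\<forall>b<B. row_block L H b \<in> ss_blocks n L x)"
proof -
  let ?K = "2 ^ L - 1 :: nat"
  let ?hit = "\<lambda>b c. int_scalar_prod (row_block L H b *\<^sub>v c) x = 1"
  have K: "?K > 0"
    using one_less_power[of "2 :: nat", OF _ \<open>L > 0\<close>] by simp
  have B: "dim_row H div L = B"
    using H \<open>L > 0\<close> by simp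
  have C: "coeff_vec L ` {1..?K} = carrier_vec L - {0\<^sub>v L}"
    using bij_betw_coeff_vec by (rule bij_betw_imp_surj_on)
  have "is_ss_vec (redundant_ext L H) x
      \<longleftrightarrow> (\<forall>i < ?K * B. \<not> ?hit (i div ?K) (coeff_vec L (i mod ?K + 1)))"
  proof -
    have "dim_row (redundant_ext L H) = ?K * B" "dim_col (redundant_ext L H) = n"
      using H by (simp_all only: redundant_ext_def dim_row_mat dim_col_mat B) simp
    then show ?thesis
      using x row_redundant_ext[of _ L H] by (auto simp: is_ss_vec_def num_one_rows_def B)
  qed
  also have "\<dots> \<longleftrightarrow> (\<forall>b<B. \<forall>k<?K. \<not> ?hit b (coeff_vec L (k + 1)))"
  proof (intro iffI allI impI)
    fix b k assume *: "\<forall>i < ?K * B. \<not> ?hit (i div ?K) (coeff_vec L (i mod ?K + 1))"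
      and bk: "b < B" "k < ?K"
    \<comment> \<open>The row belonging to block \<open>b\<close> and number \<open>k + 1\<close>
      lies within the extension.\<close>
    have "b * ?K + k < Suc b * ?K"
      using bk by simp
    also have "\<dots> \<le> B * ?K"
      using bk by (intro mult_le_mono1) simp
    finally have "b * ?K + k < ?K * B"
      by (simp only: mult.commute)
    moreover have "(b * ?K + k) div ?K = b" "(b * ?K + k) mod ?K = k"
      using bk by (simp_all del: One_nat_def)
    ultimately show "\<not> ?hit b (coeff_vec L (k + 1))"
      using * by metis
  next
    fix i assume "\<forall>b<B. \<forall>k<?K. \<not> ?hit b (coeff_vec L (k + 1))" and "i < ?K * B"
    moreover from this have "i div ?K < B"
      by (metis less_mult_imp_div_less mult.commute)
    moreover have "i mod ?K < ?K"
      using K by (rule mod_less_divisor)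
    ultimately show "\<not> ?hit (i div ?K) (coeff_vec L (i mod ?K + 1))"
      by blast
  qed
  also have "\<dots> \<longleftrightarrow> (\<forall>b<B. \<forall>k\<in>{1..?K}. \<not> ?hit b (coeff_vec L k))"
  proof -
    have "{1..?K} = (\<lambda>k. k + 1) ` {..<?K}"
      by (simp add: image_Suc_lessThan)
    then show ?thesis
      by auto
  qed
  \<comment> \<open>The numbers from 1 to \<open>?K\<close> enumerate exactly the nonzero
    coefficient vectors.\<close>
  also have "\<dots> \<longleftrightarrow> (\<forall>b<B. \<forall>c \<in> carrier_vec L - {0\<^sub>v L}. \<not> ?hit b c)"
    by (simp flip: C)
  also have "\<dots> \<longleftrightarrow> (\<forall>b<B. row_block L H b \<in> ss_blocks n L x)"
    using H by (simp add: ss_blocks_def row_block_def)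
  finally show ?thesis .
qed

lemma card_ss_redundant_ext:
  assumes "L > 0" and x: "x \<in> carrier_vec n"
  shows "card {H \<in> carrier_mat (B * L) n. is_ss_vec (redundant_ext L H) x}
    = card (ss_blocks n L x) ^ B"
proof -
  let ?\<Phi> = "\<lambda>H. \<lambda>b\<in>{..<B}. row_block L H b"
  let ?X = "{H \<in> carrier_mat (B * L) n. is_ss_vec (redundant_ext L H) x}"
  have \<Phi>: "inj_on ?\<Phi> (carrier_mat (B * L) n)"
    "?\<Phi> ` carrier_mat (B * L) n = {..<B} \<rightarrow>\<^sub>E carrier_mat n L"
    using bij_betw_row_blocks[OF \<open>L > 0\<close>, of B n] unfolding bij_betw_def by blast+
  have X: "?X = {H \<in> carrier_mat (B * L) n. ?\<Phi> H \<in> {..<B} \<rightarrow>\<^sub>E ss_blocks n L x}"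
    by (auto simp: is_ss_vec_redundant_ext_iff[OF \<open>L > 0\<close> _ x])
  have "ss_blocks n L x \<subseteq> carrier_mat n L"
    by (auto simp: ss_blocks_def)
  \<comment> \<open>Every tuple of good blocks comes from some matrix, so the good matrices fill the
    whole product set.\<close>
  then have "({..<B} \<rightarrow>\<^sub>E ss_blocks n L x) \<subseteq> ?\<Phi> ` carrier_mat (B * L) n"
    unfolding \<Phi>(2) by (intro PiE_mono) auto
  then have "?\<Phi> ` ?X = {..<B} \<rightarrow>\<^sub>E ss_blocks n L x"
    unfolding X by blast
  moreover have "inj_on ?\<Phi> ?X"
    using \<Phi>(1) by (rule inj_on_subset) auto
  ultimately have "card ?X = card ({..<B} \<rightarrow>\<^sub>E ss_blocks n L x)"
    by (metis (no_types, lifting) card_image)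
  then show ?thesis
    by (simp add: card_PiE)
qed

section \<open>Averaging over the ensemble and the final bounds\<close>

lemma avg_ss_weight_dist_eq:
  assumes "L > 0"
  shows "avg_ss_weight_dist (redundant_ensemble (B * L) n L) w
    = (\<Sum>x | x \<in> carrier_vec n \<and> hamming_weight x = w.
        (real (card (ss_blocks n L x)) / 2 ^ (n * L)) ^ B)"
proof -
  let ?X = "{x \<in> carrier_vec n. hamming_weight x = w}"
  let ?M = "carrier_mat (B * L) n :: bit mat set"
  let ?R = "\<lambda>H x. is_ss_vec (redundant_ext L H) x"
  have fin: "finite ?X" "finite ?M"
    by (simp_all add: finite_carrier_vec_bit finite_carrier_mat_bit)
  have "real (ss_weight_dist (redundant_ext L H) w) = (\<Sum>x\<in>?X. of_bool (?R H x))" if "H \<in> ?M" for H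
  proof -
    have "{x. ?R H x \<and> hamming_weight x = w} = ?X \<inter> {x. ?R H x}"
      using that by (auto simp: is_ss_vec_def redundant_ext_def)
    then show ?thesis
      using fin(1) by (simp add: ss_weight_dist_def sum_of_bool_eq)
  qed
  then have "(\<Sum>H\<in>?M. real (ss_weight_dist (redundant_ext L H) w))
      = (\<Sum>H\<in>?M. \<Sum>x\<in>?X. of_bool (?R H x))"
    by (intro sum.cong) auto
  \<comment> \<open>Linearity of expectation: for each fixed \<open>x\<close> the matrices that have
    it as a stopping set vector are counted.\<close>
  also have "\<dots> = (\<Sum>x\<in>?X. \<Sum>H\<in>?M. of_bool (?R H x))"
    by (rule sum.swap)
  also have "\<dots> = (\<Sum>x\<in>?X. real (card (ss_blocks n L x)) ^ B)"
  proof (intro sum.cong refl)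
    fix x assume "x \<in> ?X"
    then have "card (?M \<inter> {H. ?R H x}) = card (ss_blocks n L x) ^ B"
      using card_ss_redundant_ext[OF assms, of x n B] by (simp add: Int_def)
    then show "(\<Sum>H\<in>?M. of_bool (?R H x)) = real (card (ss_blocks n L x)) ^ B"
      using fin(2) by (simp add: sum_of_bool_eq)
  qed
  finally show ?thesis
    \<comment> \<open>The normalisation \<open>2 ^ (B * L * n)\<close> is the \<open>B\<close>-th
      power of the number of single blocks.\<close>
    by (simp add: avg_ss_weight_dist_redundant_ensemble sum_divide_distrib power_divide
        flip: power_mult) (simp add: ac_simps)
qed

theorem theorem2:
  fixes m n L w :: nat and A :: real
  assumes "1 \<le> m" and "m < n" and "1 \<le> L" and "L dvd m"
    and "1 \<le> w" and "w \<le> n"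
    and "A = max (1 - (2 ^ L - 1) * (real w / 2 ^ w)) 0"
  shows "avg_ss_weight_dist (redundant_ensemble m n L) w
           \<ge> real (n choose w) * max (A ^ (m div L)) (1 / 2 ^ m)
         \<and> avg_ss_weight_dist (redundant_ensemble m n L) w
           \<le> real (n choose w) *
              ((1 - real w / 2 ^ w) /
               ((2 ^ L - 1) * (real w / 2 ^ w) + 1 - real w / 2 ^ w)) ^ (m div L)"
proof -
  define B where "B = m div L"
  have m: "m = B * L" and L: "L > 0"
    using assms by (simp_all add: B_def)
  let ?X = "{x \<in> carrier_vec n. hamming_weight x = w}"
  let ?q = "\<lambda>x. real (card (ss_blocks n L x)) / 2 ^ (n * L)"
  let ?u = "(1 - real w / 2 ^ w) / ((2 ^ L - 1) * (real w / 2 ^ w) + 1 - real w / 2 ^ w)"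
  have avg: "avg_ss_weight_dist (redundant_ensemble m n L) w = (\<Sum>x\<in>?X. ?q x ^ B)"
    unfolding m by (rule avg_ss_weight_dist_eq[OF L])
  have lower: "max (A ^ B) (1 / 2 ^ m) \<le> ?q x ^ B" if "x \<in> ?X" for x
  proof -
    have "hamming_weight (0\<^sub>v n) = 0"
      by (simp add: hamming_weight_def)
    then have x: "x \<in> carrier_vec n" "hamming_weight x = w" "x \<noteq> 0\<^sub>v n"
      using that \<open>1 \<le> w\<close> by auto
    have "A \<le> ?q x"
      using card_ss_blocks_ge_union_bound[OF x(1), of L] x(2)
      by (simp add: assms(7) field_simps)
    \<comment> \<open>Monotonicity of powers needs \<open>0 \<le> A\<close>, which the truncation at
      zero in \<open>A\<close> provides.\<close>
    then have "A ^ B \<le> ?q x ^ B"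
      by (rule power_mono) (simp add: assms(7))
    moreover have "1 / 2 ^ L \<le> ?q x"
      using card_ss_blocks_ge_orthogonal[OF x(1,3), of L] by (simp add: field_simps)
    \<comment> \<open>The left-hand side is \<open>1 / 2 ^ m\<close> because
      \<open>m = B * L\<close>.\<close>
    then have "(1 / 2 ^ L) ^ B \<le> ?q x ^ B"
      by (rule power_mono) simp
    ultimately show ?thesis
      by (simp add: m power_divide mult.commute flip: power_mult)
  qed
  have upper: "?q x ^ B \<le> ?u ^ B" if "x \<in> ?X" for x
  proof (rule power_mono)
    show "?q x \<le> ?u"
      using card_ss_blocks_le[of x n L] that by (simp add: pos_divide_le_eq mult.commute)
  qed simp
  show ?thesis
    \<comment> \<open>The sum has \<open>n choose w\<close> terms, each within the same two
      bounds.\<close>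
    unfolding avg
    using sum_bounded_below[of ?X, OF lower] sum_bounded_above[of ?X, OF upper]
    by (simp add: card_hamming_weight B_def)
qed

end
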